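(* For every $i\in\mathcal I$, $j\in\mathcal J$, $z_0\in\mathcal Z_0$ and $p\in\mathcal P$, $$\int_{\xi_j(z_0,p)\oplus\langle 0,\;G^{\mathrm{obs}}\rangle}q_{i,j}(w)\,dw\;\le\;\sum_{\mathcal S\in\overline{\mathcal S}_j(z_0)}\int_{\mathcal S+A_jp}q_{i,j,\mathcal S}(w,p)\,dw.$$
   Context: Zonotope notation: for $c\in\mathbb R^n$ and $G=[g_1,\dots,g_\ell]\in\mathbb R^{n\times\ell}$, $\langle c,\;G\rangle=\{c+\sum_{k=1}^\ell\beta_kg_k\mid\beta_k\in[-1,1]\}$; $\oplus$ is the Minkowski sum. $\mathcal W\subset\mathbb R^2$ is the world space; all planar sets considered (including the translated triangles $\mathcal S+A_jp$, $p\in\mathcal P$) lie in $\mathcal W$. $\mathcal I$ (obstacles) and $\mathcal J$ (time intervals) are finite index sets, $\mathcal Z_0\subset\mathbb R^6$ is the set of initial conditions, $\mathcal P\subset\mathbb R^{n_p}$ is the set of trajectory parameters. For each $(i,j)\in\mathcal I\times\mathcal J$, $q_{i,j}:\mathcal W\to[0,\infty)$ is a twice-differentiable probability density function; $\frac{\partial q_{i,j}}{\partial w}$ is its gradient as a row vector. $G^{\mathrm{obs}}$ is a constant matrix with 2 rows. For each $j$, $\xi_j(z_0,p)=\langle c_j(z_0)+A_jp,\;G_j\rangle\subset\mathbb R^2$ with $c_j:\mathcal Z_0\to\mathbb R^2$ linear, $A_j\in\mathbb R^{2\times n_p}$, and $G_j$ a matrix with 2 rows. Triangles: for a fixed positive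 integer $k$, cover the zonotope $\langle c_j(z_0),\;[G_j,G^{\mathrm{obs}}]\rangle$ by an axis-aligned $k\times k$ grid of rectangular cells of equal size. Each cell is cut along the diagonal joining its upper-left and lower-right corners into two right-angled triangles: the lower one (index $1$), whose right-angle vertex is the lower-left corner of the cell, and the upper one (index $-1$), whose right-angle vertex is the upper-right corner. $\overline{\mathcal S}_j(z_0)$ is the collection of those triangles having nonempty intersection with $\langle c_j(z_0),\;[G_j,G^{\mathrm{obs}}]\rangle$. For $\mathcal S\in\overline{\mathcal S}_j(z_0)$ with right-angle vertex $w^{\mathrm{ctr}}_{\mathcal S}$, $$q_{i,j,\mathcal S}(w,p)=q_{i,j}(w^{\mathrm{ctr}}_{\mathcal S}+A_jp)+\frac{\partial q_{i,j}}{\partial w}(w^{\mathrm{ctr}}_{\mathcal S}+A_jp)\,(w-w^{\mathrm{ctr}}_{\mathcal S}-A_jp)+\tfrac12(w-w^{\mathrm{ctr}}_{\mathcal S}-A_jp)^\top H_{\mathcal S}\,(w-w^{\mathrm{ctr}}_{\mathcal S}-A_jp),$$ where $H_{\mathcal S}\in\mathbb R^{2\times2}$ is obtained by taking the element-wise supremum of the Hessian of $q_{i,j}$ over $\mathcal S\oplus A_j\mathcal P=\{s+A_jp'\mid s\in\mathcal S,\,p'\in\mathcal P\}$ using interval arithmetic (so each entry is a finite real number that is at least the supremum of the corresponding Hessian entry over that set). *)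

theory Defs
  imports "HOL-Analysis.Analysis" "HOL-Library.Set_Algebras"
begin

text \<open>Generator matrices are lists of columns, so that the number of generators may vary
  with the time interval; juxtaposition of matrices is list append.\<close>

definition zonotope :: "real ^ 'n \<Rightarrow> (real ^ 'n) list \<Rightarrow> (real ^ 'n) set" where
  "zonotope c G = {c + (\<Sum>k<length G. \<beta> k *\<^sub>R G ! k) | \<beta>. \<forall>k<length G. \<beta> k \<in> {-1..1}}"

definition xi ::
  "('z \<Rightarrow> real ^ 2) \<Rightarrow> real ^ 'p ^ 2 \<Rightarrow> (real ^ 2) list \<Rightarrow> 'z \<Rightarrow> real ^ 'p \<Rightarrow> (real ^ 2) set" where
  "xi c A G z p = zonotope (c z + A *v p) G"

definition pdf_on :: "(real ^ 2) set \<Rightarrow> (real ^ 2 \<Rightarrow> real) \<Rightarrow> bool" where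
  "pdf_on W q \<longleftrightarrow> (\<forall>w\<in>W. 0 \<le> q w) \<and> set_integrable lebesgue W q
     \<and> (LINT w:W|lebesgue. q w) = 1"

text \<open>Derivatives are taken within \<open>W\<close>, since the world space is not assumed to be open; on
  interior points they are the usual gradient and Hessian.\<close>

definition has_gradient_Hessian_on ::
  "(real ^ 2) set \<Rightarrow> (real ^ 2 \<Rightarrow> real) \<Rightarrow> (real ^ 2 \<Rightarrow> real ^ 2) \<Rightarrow> (real ^ 2 \<Rightarrow> real ^ 2 ^ 2) \<Rightarrow> bool"
  where
  "has_gradient_Hessian_on W q Dq Hq \<longleftrightarrow>
     (\<forall>w\<in>W. (q has_derivative (\<lambda>h. Dq w \<bullet> h)) (at w within W)
           \<and> (Dq has_derivative (\<lambda>h. Hq w *v h)) (at w within W))"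

text \<open>The first vertex is the one carrying the right angle.\<close>

datatype triangle = Triangle (ctr: "real ^ 2") (horizontal: "real ^ 2") (vertical: "real ^ 2")

definition region :: "triangle \<Rightarrow> (real ^ 2) set" where
  "region S = convex hull {ctr S, horizontal S, vertical S}"

definition grid_point :: "real ^ 2 \<Rightarrow> real ^ 2 \<Rightarrow> nat \<Rightarrow> nat \<Rightarrow> real ^ 2" where
  "grid_point orig sz a b = vector [orig $ 1 + real a * sz $ 1, orig $ 2 + real b * sz $ 2]"

definition grid_cell :: "real ^ 2 \<Rightarrow> real ^ 2 \<Rightarrow> nat \<Rightarrow> nat \<Rightarrow> (real ^ 2) set" where
  "grid_cell orig sz a b = cbox (grid_point orig sz a b) (grid_point orig sz (a + 1) (b + 1))"

definition lower_triangle :: "real ^ 2 \<Rightarrow> real ^ 2 \<Rightarrow> nat \<Rightarrow> nat \<Rightarrow> triangle" where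
  "lower_triangle orig sz a b =
     Triangle (grid_point orig sz a b) (grid_point orig sz (a + 1) b) (grid_point orig sz a (b + 1))"

definition upper_triangle :: "real ^ 2 \<Rightarrow> real ^ 2 \<Rightarrow> nat \<Rightarrow> nat \<Rightarrow> triangle" where
  "upper_triangle orig sz a b =
     Triangle (grid_point orig sz (a + 1) (b + 1))
       (grid_point orig sz a (b + 1)) (grid_point orig sz (a + 1) b)"

definition grid_covers :: "nat \<Rightarrow> real ^ 2 \<Rightarrow> real ^ 2 \<Rightarrow> (real ^ 2) set \<Rightarrow> bool" where
  "grid_covers k orig sz Z \<longleftrightarrow>
     0 < sz $ 1 \<and> 0 < sz $ 2 \<and> Z \<subseteq> (\<Union>a<k. \<Union>b<k. grid_cell orig sz a b)"

definition grid_triangles :: "nat \<Rightarrow> real ^ 2 \<Rightarrow> real ^ 2 \<Rightarrow> triangle set" where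
  "grid_triangles k orig sz =
     (\<Union>a<k. \<Union>b<k. {lower_triangle orig sz a b, upper_triangle orig sz a b})"

definition Sbar :: "nat \<Rightarrow> real ^ 2 \<Rightarrow> real ^ 2 \<Rightarrow> (real ^ 2) set \<Rightarrow> triangle set" where
  "Sbar k orig sz Z = {S \<in> grid_triangles k orig sz. region S \<inter> Z \<noteq> {}}"

text \<open>The supremum is taken in the extended reals, so the inequality with a real number on the
  right also expresses that it is finite above.\<close>

definition entrywise_sup_bound ::
  "(real ^ 2 \<Rightarrow> real ^ 2 ^ 2) \<Rightarrow> (real ^ 2) set \<Rightarrow> real ^ 2 ^ 2 \<Rightarrow> bool" where
  "entrywise_sup_bound Hq X H \<longleftrightarrow>
     (\<forall>a b. (SUP w\<in>X. ereal (Hq w $ a $ b)) \<le> ereal (H $ a $ b))"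

definition q_tri ::
  "(real ^ 2 \<Rightarrow> real) \<Rightarrow> (real ^ 2 \<Rightarrow> real ^ 2) \<Rightarrow> real ^ 'p ^ 2 \<Rightarrow> real ^ 2 ^ 2 \<Rightarrow> triangle
     \<Rightarrow> real ^ 2 \<Rightarrow> real ^ 'p \<Rightarrow> real" where
  "q_tri q Dq A H S w p =
     q (ctr S + A *v p) + Dq (ctr S + A *v p) \<bullet> (w - ctr S - A *v p)
     + 1 / 2 * ((w - ctr S - A *v p) \<bullet> (H *v (w - ctr S - A *v p)))"

end

(* A world-space point of a triangle differs from the right-angle vertex by a vector h whose
   coordinates have the same sign, so all products h_a h_b are nonnegative and the entrywise bound
   on the Hessian bounds the quadratic form along the segment from the vertex. Taylor's formula then
   gives q <= q_tri on each triangle. As q is nonnegative and the translated triangles cover the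
   translated zonotope, their possible overlaps only increase the right-hand side. *)

theory Submission
  imports Defs
begin

section \<open>Taylor bounds and quadratic forms\<close>

text \<open>Since \<open>g''\<close> is known only pointwise, the mean value theorem is used twice
  in place of an integral remainder: first on \<open>g'\<close>, then on \<open>g\<close> minus its
  candidate quadratic majorant.\<close>

lemma second_derivative_bound:
  fixes g g' g'' :: "real \<Rightarrow> real"
  assumes g: "\<And>t. t \<in> {0..1} \<Longrightarrow> (g has_real_derivative g' t) (at t within {0..1})"
    and g': "\<And>t. t \<in> {0..1} \<Longrightarrow> (g' has_real_derivative g'' t) (at t within {0..1})"
    and M: "\<And>t. t \<in> {0..1} \<Longrightarrow> g'' t \<le> M"
  shows "g 1 \<le> g 0 + g' 0 + M / 2"
proof -
  have D1: "g' t \<le> g' 0 + M * t" if t: "t \<in> {0..1}" for t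
  proof (cases "t = 0")
    case False
    with t have "0 < t" by auto
    have "\<exists>x\<in>{0<..<t}. g' t - g' 0 = (t - 0) * g'' x"
    proof -
      have "(g' has_derivative (\<lambda>h. h * g'' x)) (at x within {0..t})" if "0 \<le> x" "x \<le> t" for x
        using g'[of x] that t has_derivative_subset[of g' _ x "{0..1}" "{0..t}"]
        by (auto simp: has_field_derivative_def mult_commute_abs)
      from mvt_simple[OF \<open>0 < t\<close> this] show ?thesis by auto
    qed
    then obtain x where x: "x \<in> {0<..<t}" "g' t - g' 0 = t * g'' x" by auto
    have "t * g'' x \<le> t * M"
      using M[of x] x t by (intro mult_left_mono) auto
    with x(2) show ?thesis using mult.commute[of M t] by linarith
  qed simp
  \<comment> \<open>\<open>D1\<close> says that the derivative of \<open>f\<close> is nonpositive,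
    and f 1 \<le> f 0 is exactly the claim.\<close>
  define f where "f t = g t - g' 0 * t - M / 2 * t\<^sup>2" for t
  have "(f has_derivative (\<lambda>h. (g' t - g' 0 - M * t) * h)) (at t within {0..1})"
    if "0 \<le> t" "t \<le> 1" for t
  proof -
    have "(f has_real_derivative (g' t - g' 0 - M * t)) (at t within {0..1})"
      unfolding f_def by (rule derivative_eq_intros g refl | use that in simp)+
    then show ?thesis by (simp add: has_field_derivative_def)
  qed
  from mvt_simple[OF zero_less_one this]
  obtain x where "x \<in> {0<..<1}" "f 1 - f 0 = (g' x - g' 0 - M * x) * (1 - 0)" by blast
  with D1[of x] show ?thesis by (auto simp: f_def)
qed

text \<open>Restricting \<open>q\<close> to the segment reduces this to one variable; the second
  derivative of the restriction is the quadratic form of the Hessian in direction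
  \<open>y - x\<close>.\<close>

lemma Taylor_upper_bound:
  assumes D: "has_gradient_Hessian_on W q Dq Hq" and seg: "closed_segment x y \<subseteq> W"
    and M: "\<And>z. z \<in> closed_segment x y \<Longrightarrow> (y - x) \<bullet> (Hq z *v (y - x)) \<le> M"
  shows "q y \<le> q x + Dq x \<bullet> (y - x) + M / 2"
proof -
  define l where "l t = x + t *\<^sub>R (y - x)" for t :: real
  have l: "l t \<in> closed_segment x y" if "t \<in> {0..1}" for t
    using that by (auto simp: l_def closed_segment_def algebra_simps intro!: exI[of _ t])
  have dl: "(l has_derivative (\<lambda>h. h *\<^sub>R (y - x))) (at t within {0..1})" for t
    unfolding l_def by (auto intro!: derivative_eq_intros)
  have lW: "l ` {0..1} \<subseteq> W" using l seg by auto
  \<comment> \<open>Derivatives within \<open>W\<close> can be composed with \<open>l\<close>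
    because \<open>l\<close> maps the unit interval into \<open>W\<close>. The codomain is left
    general to serve both \<open>q\<close> and \<open>Dq\<close>.\<close>
  have chain: "((\<lambda>t. f (l t)) has_derivative (\<lambda>h. f' (h *\<^sub>R (y - x)))) (at t within {0..1})"
    if "(f has_derivative f') (at (l t) within W)" for f :: "real ^ 2 \<Rightarrow> 'b::real_normed_vector" and f' t
    using diff_chain_within[OF dl has_derivative_subset[OF that lW]] by (simp add: o_def)
  have "(\<lambda>t. q (l t)) 1 \<le> (\<lambda>t. q (l t)) 0 + (\<lambda>t. Dq (l t) \<bullet> (y - x)) 0 + M / 2"
  proof (rule second_derivative_bound)
    fix t :: real assume t: "t \<in> {0..1}"
    then have W: "l t \<in> W" using lW by auto
    have "(q has_derivative (\<lambda>h. Dq (l t) \<bullet> h)) (at (l t) within W)"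
      using D W by (simp add: has_gradient_Hessian_on_def)
    from chain[OF this]
    show "((\<lambda>t. q (l t)) has_real_derivative Dq (l t) \<bullet> (y - x)) (at t within {0..1})"
      by (simp add: has_field_derivative_def mult_commute_abs)
    have "(Dq has_derivative (\<lambda>h. Hq (l t) *v h)) (at (l t) within W)"
      using D W by (simp add: has_gradient_Hessian_on_def)
    from has_derivative_inner_left[OF chain[OF this], of "y - x"]
    show "((\<lambda>t. Dq (l t) \<bullet> (y - x)) has_real_derivative (y - x) \<bullet> (Hq (l t) *v (y - x)))
        (at t within {0..1})"
      by (simp add: has_field_derivative_def mult_commute_abs inner_commute matrix_vector_mult_scaleR)
    show "(y - x) \<bullet> (Hq (l t) *v (y - x)) \<le> M" by (rule M[OF l[OF t]])
  qed
  then show ?thesis by (simp add: l_def)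
qed

text \<open>The difference of the two forms is the sum of the products of h_a h_b with C_ab - B_ab,
  each of them nonnegative.\<close>

lemma quadratic_form_mono:
  fixes h :: "real ^ 'n" and B C :: "real ^ 'n ^ 'n"
  assumes "\<And>a b. 0 \<le> h $ a * h $ b" and "\<And>a b. B $ a $ b \<le> C $ a $ b"
  shows "h \<bullet> (B *v h) \<le> h \<bullet> (C *v h)"
proof -
  have "h $ a * (B $ a $ b * h $ b) \<le> h $ a * (C $ a $ b * h $ b)" for a b
    using mult_right_mono[OF assms(2)[of a b] assms(1)[of a b]] by (simp add: ac_simps)
  then show ?thesis
    by (auto simp: inner_vec_def matrix_vector_mult_def sum_distrib_left intro!: sum_mono)
qed

lemma entrywise_sup_boundD:
  assumes "entrywise_sup_bound Hq X H" "w \<in> X"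
  shows "Hq w $ a $ b \<le> H $ a $ b"
  using assms SUP_upper[of w X "\<lambda>w. ereal (Hq w $ a $ b)"] order_trans
  unfolding entrywise_sup_bound_def by fastforce

section \<open>Geometry of the grid and of the zonotopes\<close>

text \<open>From the right-angle vertex both legs point in positive axis directions (lower triangle)
  or both in negative ones (upper triangle). This is where the choice of diagonal matters: the other
  one would give mixed signs.\<close>

lemma grid_triangle_offset_sign:
  assumes S: "S \<in> grid_triangles k orig sz" and sz: "0 < sz $ 1" "0 < sz $ 2" and w: "w \<in> region S"
  shows "0 \<le> (w - ctr S) $ a * (w - ctr S) $ b"
proof -
  obtain u v where uv: "0 \<le> u" "0 \<le> v"
      "w = ctr S + u *\<^sub>R (horizontal S - ctr S) + v *\<^sub>R (vertical S - ctr S)"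
    using w by (auto simp: region_def convex_hull_3_alt)
  from S obtain m n where "S = lower_triangle orig sz m n \<or> S = upper_triangle orig sz m n"
    by (auto simp: grid_triangles_def)
  then have "(w - ctr S) $ 1 = u * sz $ 1 \<and> (w - ctr S) $ 2 = v * sz $ 2
      \<or> (w - ctr S) $ 1 = - (u * sz $ 1) \<and> (w - ctr S) $ 2 = - (v * sz $ 2)"
    by (auto simp: uv(3) lower_triangle_def upper_triangle_def grid_point_def algebra_simps)
  then show ?thesis
    using uv sz exhaust_2[of a] exhaust_2[of b] by (elim disjE conjE) simp_all
qed

text \<open>In cell coordinates \<open>s\<close>, \<open>t\<close> in [0,1] the cutting diagonal is
  s + t = 1, so the sign of s + t - 1 selects the triangle.\<close>

lemma grid_cell_subset_triangles:
  assumes sz: "0 < sz $ 1" "0 < sz $ 2" and w: "w \<in> grid_cell orig sz a b"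
  shows "w \<in> region (lower_triangle orig sz a b) \<union> region (upper_triangle orig sz a b)"
proof -
  define s t where "s = (w $ 1 - orig $ 1) / sz $ 1 - a" and "t = (w $ 2 - orig $ 2) / sz $ 2 - b"
  have w12: "w $ 1 = orig $ 1 + (a + s) * sz $ 1" "w $ 2 = orig $ 2 + (b + t) * sz $ 2"
    using sz by (simp_all add: s_def t_def field_simps)
  have "real a * sz $ 1 \<le> (a + s) * sz $ 1" "(a + s) * sz $ 1 \<le> (a + 1) * sz $ 1"
    "real b * sz $ 2 \<le> (b + t) * sz $ 2" "(b + t) * sz $ 2 \<le> (b + 1) * sz $ 2"
    using w by (auto simp: grid_cell_def mem_box_cart forall_2 grid_point_def w12 add.commute)
  then have st: "0 \<le> s" "s \<le> 1" "0 \<le> t" "t \<le> 1"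
    using sz by (auto simp: mult_le_cancel_right)
  show ?thesis
  proof (cases "s + t \<le> 1")
    case True
    let ?T = "lower_triangle orig sz a b"
    have "w = ctr ?T + s *\<^sub>R (horizontal ?T - ctr ?T) + t *\<^sub>R (vertical ?T - ctr ?T)"
      by (simp add: vec_eq_iff forall_2 w12 lower_triangle_def grid_point_def algebra_simps)
    then have "w \<in> region ?T"
      using st True unfolding region_def convex_hull_3_alt by blast
    then show ?thesis by simp
  next
    case False
    let ?T = "upper_triangle orig sz a b"
    \<comment> \<open>Coordinates are now measured backwards from the upper-right corner.\<close>
    have "w = ctr ?T + (1 - s) *\<^sub>R (horizontal ?T - ctr ?T) + (1 - t) *\<^sub>R (vertical ?T - ctr ?T)"
      by (simp add: vec_eq_iff forall_2 w12 upper_triangle_def grid_point_def algebra_simps)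
    moreover have "0 \<le> 1 - s" "0 \<le> 1 - t" "(1 - s) + (1 - t) \<le> 1" using st False by auto
    ultimately have "w \<in> region ?T"
      unfolding region_def convex_hull_3_alt by blast
    then show ?thesis by simp
  qed
qed

text \<open>Discarding triangles that miss \<open>Z\<close> loses no point of \<open>Z\<close>: a
  triangle containing such a point meets \<open>Z\<close> there.\<close>

lemma subset_Union_Sbar:
  assumes "grid_covers k orig sz Z"
  shows "Z \<subseteq> (\<Union>S\<in>Sbar k orig sz Z. region S)"
proof
  fix w assume w: "w \<in> Z"
  then obtain a b where ab: "a < k" "b < k" "w \<in> grid_cell orig sz a b"
    using assms by (force simp: grid_covers_def)
  then obtain S where "S \<in> {lower_triangle orig sz a b, upper_triangle orig sz a b}" "w \<in> region S"
    using grid_cell_subset_triangles[of sz w orig a b] assms by (auto simp: grid_covers_def)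
  then show "w \<in> (\<Union>S\<in>Sbar k orig sz Z. region S)"
    using w ab by (auto simp: Sbar_def grid_triangles_def)
qed

lemma finite_Sbar: "finite (Sbar k orig sz Z)"
  by (simp add: Sbar_def grid_triangles_def)

text \<open>Pulls the parameter-dependent shift out of the centre, so that one grid, built for the
  unshifted zonotope, serves every parameter after translation.\<close>

lemma zonotope_plus_subset:
  "zonotope (c + d) G + zonotope 0 G' \<subseteq> (\<lambda>w. w + d) ` zonotope c (G @ G')"
proof
  fix w assume "w \<in> zonotope (c + d) G + zonotope 0 G'"
  then obtain \<beta> \<gamma> where \<beta>: "\<forall>k<length G. \<beta> k \<in> {-1..1}" and \<gamma>: "\<forall>k<length G'. \<gamma> k \<in> {-1..1}"
    and w: "w = (c + d + (\<Sum>k<length G. \<beta> k *\<^sub>R G ! k)) + (\<Sum>k<length G'. \<gamma> k *\<^sub>R G' ! k)"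
    by (auto simp: zonotope_def set_plus_def)
  define \<delta> where "\<delta> k = (if k < length G then \<beta> k else \<gamma> (k - length G))" for k
  \<comment> \<open>The length of \<open>G'\<close> is generalised to \<open>n\<close> so that
    induction can split the sum at the end of \<open>G\<close>.\<close>
  have "(\<Sum>k<length G + n. \<delta> k *\<^sub>R (G @ G') ! k)
      = (\<Sum>k<length G. \<beta> k *\<^sub>R G ! k) + (\<Sum>k<n. \<gamma> k *\<^sub>R G' ! k)" for n
    by (induction n) (auto simp: \<delta>_def nth_append)
  from this[of "length G'"] have "w = (c + (\<Sum>k<length (G @ G'). \<delta> k *\<^sub>R (G @ G') ! k)) + d"
    by (simp add: w ac_simps)
  moreover have "\<forall>k<length (G @ G'). \<delta> k \<in> {-1..1}"
  proof (intro allI impI)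
    fix k assume "k < length (G @ G')"
    then show "\<delta> k \<in> {-1..1}"
      using \<beta> \<gamma> by (cases "k < length G") (auto simp: \<delta>_def)
  qed
  ultimately show "w \<in> (\<lambda>w. w + d) ` zonotope c (G @ G')"
    unfolding zonotope_def by blast
qed

section \<open>Estimate and integrability on one triangle\<close>

lemma compact_region: "compact (region S)"
  unfolding region_def by (intro finite_imp_compact_convex_hull) simp

lemma compact_translated_region: "compact ((\<lambda>w. w + d) ` region S)"
  by (intro compact_continuous_image compact_region continuous_intros)

text \<open>By convexity the segment from the right-angle vertex to \<open>w\<close> stays in the
  translated triangle, which lies in \<open>W\<close> and, as \<open>p\<close> is in
  \<open>P\<close>, in the set where \<open>H\<close> dominates the Hessian.\<close>

lemma q_le_q_tri:
  assumes D: "has_gradient_Hessian_on W q Dq Hq"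
    and S: "S \<in> grid_triangles k orig sz" and sz: "0 < sz $ 1" "0 < sz $ 2"
    and W: "(\<lambda>w. w + A *v p) ` region S \<subseteq> W" and p: "p \<in> P"
    and H: "entrywise_sup_bound Hq (region S + (*v) A ` P) H"
    and w: "w \<in> (\<lambda>w. w + A *v p) ` region S"
  shows "q w \<le> q_tri q Dq A H S w p"
proof -
  obtain v where v: "v \<in> region S" "w = v + A *v p" using w by auto
  let ?x = "ctr S + A *v p"
  \<comment> \<open>The translation cancels, so the sign lemma for the untranslated triangle
    applies.\<close>
  have h: "w - ?x = v - ctr S" by (simp add: v)
  have "?x \<in> (\<lambda>w. w + A *v p) ` region S"
    by (intro imageI) (simp add: region_def hull_inc)
  moreover have "convex ((\<lambda>w. w + A *v p) ` region S)"
    using convex_translation[of "region S" "A *v p"]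
    by (simp add: region_def convex_convex_hull add.commute)
  ultimately have seg: "closed_segment ?x w \<subseteq> (\<lambda>w. w + A *v p) ` region S"
    using w by (simp add: closed_segment_subset)
  have "q w \<le> q ?x + Dq ?x \<bullet> (w - ?x) + ((w - ?x) \<bullet> (H *v (w - ?x))) / 2"
  proof (rule Taylor_upper_bound[OF D])
    show "closed_segment ?x w \<subseteq> W" using seg W by blast
    fix z assume "z \<in> closed_segment ?x w"
    then obtain s where "s \<in> region S" "z = s + A *v p" using seg by blast
    then have "z \<in> region S + (*v) A ` P" using p by (simp add: set_plus_intro)
    then show "(w - ?x) \<bullet> (Hq z *v (w - ?x)) \<le> (w - ?x) \<bullet> (H *v (w - ?x))"
      unfolding h using entrywise_sup_boundD[OF H] grid_triangle_offset_sign[OF S sz v(1)]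
      by (intro quadratic_form_mono) auto
  qed
  then show ?thesis by (simp add: q_tri_def diff_diff_eq)
qed

text \<open>For fixed \<open>p\<close> the integrand is a quadratic polynomial in \<open>w\<close>,
  hence continuous, on a compact set; integrability then passes from \<open>lborel\<close> to its
  completion.\<close>

lemma set_integrable_q_tri:
  "set_integrable lebesgue ((\<lambda>w. w + d) ` region S) (\<lambda>w. q_tri q Dq A H S w p)"
proof -
  have "continuous_on ((\<lambda>w. w + d) ` region S) (\<lambda>w. q_tri q Dq A H S w p)"
    unfolding q_tri_def
    by (intro continuous_intros linear_continuous_on_compose[OF _ matrix_vector_mul_linear])
  then have "set_integrable lborel ((\<lambda>w. w + d) ` region S) (\<lambda>w. q_tri q Dq A H S w p)"
    unfolding set_integrable_def
    by (intro borel_integrable_compact compact_translated_region)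
  then show ?thesis
    unfolding set_integrable_def
    by (simp only: integrable_completion borel_measurable_integrable measurable_lborel1)
qed

text \<open>The informal statement asks only that the grid cover the zonotope, so its corner
  \<open>orig\<close> and cell size \<open>sz\<close> are arbitrary functions of \<open>j\<close>
  and \<open>z0\<close>.\<close>

theorem mainTheorem3:
  fixes W :: "(real ^ 2) set"
    and I :: "'i set" and J :: "'j set"
    and Z0 :: "(real ^ 6) set" and P :: "(real ^ 'p) set"
    and q :: "'i \<Rightarrow> 'j \<Rightarrow> real ^ 2 \<Rightarrow> real"
    and Dq :: "'i \<Rightarrow> 'j \<Rightarrow> real ^ 2 \<Rightarrow> real ^ 2"
    and Hq :: "'i \<Rightarrow> 'j \<Rightarrow> real ^ 2 \<Rightarrow> real ^ 2 ^ 2"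
    and c :: "'j \<Rightarrow> real ^ 6 \<Rightarrow> real ^ 2"
    and A :: "'j \<Rightarrow> real ^ 'p ^ 2"
    and G :: "'j \<Rightarrow> (real ^ 2) list" and Gobs :: "(real ^ 2) list"
    and k :: nat
    and orig sz :: "'j \<Rightarrow> real ^ 6 \<Rightarrow> real ^ 2"
    and H :: "'i \<Rightarrow> 'j \<Rightarrow> triangle \<Rightarrow> real ^ 2 ^ 2"
    and SS :: "'j \<Rightarrow> real ^ 6 \<Rightarrow> triangle set"
  assumes "finite I" and "finite J"
    and pdf: "\<And>i j. i \<in> I \<Longrightarrow> j \<in> J \<Longrightarrow> pdf_on W (q i j)"
    and smooth: "\<And>i j. i \<in> I \<Longrightarrow> j \<in> J \<Longrightarrow> has_gradient_Hessian_on W (q i j) (Dq i j) (Hq i j)"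
    and lin: "\<And>j. j \<in> J \<Longrightarrow> linear (c j)"
    and k: "0 < k"
    and cover: "\<And>j z0. j \<in> J \<Longrightarrow> z0 \<in> Z0 \<Longrightarrow>
        grid_covers k (orig j z0) (sz j z0) (zonotope (c j z0) (G j @ Gobs))"
    and SS: "\<And>j z0. j \<in> J \<Longrightarrow> z0 \<in> Z0 \<Longrightarrow>
        SS j z0 = Sbar k (orig j z0) (sz j z0) (zonotope (c j z0) (G j @ Gobs))"
    and world: "\<And>j z0 S p. j \<in> J \<Longrightarrow> z0 \<in> Z0 \<Longrightarrow> S \<in> SS j z0 \<Longrightarrow> p \<in> P \<Longrightarrow>
        (\<lambda>w. w + A j *v p) ` region S \<subseteq> W"
    and hess: "\<And>i j z0 S. i \<in> I \<Longrightarrow> j \<in> J \<Longrightarrow> z0 \<in> Z0 \<Longrightarrow> S \<in> SS j z0 \<Longrightarrow>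
        entrywise_sup_bound (Hq i j) (region S + (*v) (A j) ` P) (H i j S)"
  shows "\<forall>i\<in>I. \<forall>j\<in>J. \<forall>z0\<in>Z0. \<forall>p\<in>P.
      (LINT w:(xi (c j) (A j) (G j) z0 p + zonotope 0 Gobs)|lebesgue. q i j w)
      \<le> (\<Sum>S\<in>SS j z0. LINT w:(\<lambda>w. w + A j *v p) ` region S|lebesgue.
            q_tri (q i j) (Dq i j) (A j) (H i j S) S w p)"
proof (intro ballI)
  fix i j z0 p assume i: "i \<in> I" and j: "j \<in> J" and z0: "z0 \<in> Z0" and p: "p \<in> P"
  let ?Z = "zonotope (c j z0) (G j @ Gobs)" and ?q = "q i j"
  let ?X = "xi (c j) (A j) (G j) z0 p + zonotope 0 Gobs"
  let ?T = "\<lambda>S. (\<lambda>w. w + A j *v p) ` region S"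
  let ?Q = "\<lambda>S w. q_tri ?q (Dq i j) (A j) (H i j S) S w p"
  note grid = cover[OF j z0]
  have fin: "finite (SS j z0)" by (simp add: SS[OF j z0] finite_Sbar)
  have TW: "?T S \<subseteq> W" if "S \<in> SS j z0" for S by (rule world[OF j z0 that p])
  have q0: "0 \<le> ?q w" if "w \<in> W" for w using pdf[OF i j] that by (simp add: pdf_on_def)
  \<comment> \<open>Integrability is inherited from \<open>W\<close>: on the smaller, compact and
    hence measurable set \<open>?T S\<close> the indicator of \<open>W\<close> is absorbed.\<close>
  have int: "set_integrable lebesgue (?T S) ?q" if "S \<in> SS j z0" for S
  proof -
    have "integrable lebesgue (\<lambda>w. indicator W w *\<^sub>R ?q w)"
      using pdf[OF i j] by (simp add: pdf_on_def set_integrable_def)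
    moreover have "?T S \<in> sets lebesgue"
      using compact_translated_region lmeasurable_compact fmeasurableD by blast
    ultimately have "integrable lebesgue (\<lambda>w. indicator (?T S) w *\<^sub>R (indicator W w *\<^sub>R ?q w))"
      by (rule integrable_mult_indicator[rotated])
    moreover have "(\<lambda>w. indicator (?T S) w *\<^sub>R (indicator W w *\<^sub>R ?q w)) = (\<lambda>w. indicator (?T S) w *\<^sub>R ?q w)"
      using TW[OF that] by (auto simp: fun_eq_iff indicator_def)
    ultimately show ?thesis by (simp add: set_integrable_def)
  qed
  have X: "?X \<subseteq> (\<Union>S\<in>SS j z0. ?T S)"
  proof -
    have "?X \<subseteq> (\<lambda>w. w + A j *v p) ` ?Z" by (simp add: xi_def zonotope_plus_subset)
    also have "\<dots> \<subseteq> (\<lambda>w. w + A j *v p) ` (\<Union>S\<in>SS j z0. region S)"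
      unfolding SS[OF j z0] by (rule image_mono[OF subset_Union_Sbar[OF grid]])
    finally show ?thesis by (simp add: image_UN)
  qed
  have pos: "0 \<le> indicator (?T S) w *\<^sub>R ?q w" if "S \<in> SS j z0" for S w
    using q0 TW[OF that] by (auto simp: indicator_def)
  have "(LINT w:?X|lebesgue. ?q w) \<le> (LINT w|lebesgue. (\<Sum>S\<in>SS j z0. indicator (?T S) w *\<^sub>R ?q w))"
    unfolding set_lebesgue_integral_def
  \<comment> \<open>This rule asks for integrability of the majorant only: a non-integrable left
    integrand would have integral 0 by convention, which the nonnegative majorant still
    bounds.\<close>
  proof (rule integral_mono')
    show "integrable lebesgue (\<lambda>w. \<Sum>S\<in>SS j z0. indicator (?T S) w *\<^sub>R ?q w)"
      using int by (auto simp: set_integrable_def intro!: Bochner_Integration.integrable_sum)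
    fix w
    show "0 \<le> (\<Sum>S\<in>SS j z0. indicator (?T S) w *\<^sub>R ?q w)" by (intro sum_nonneg pos)
    show "indicator ?X w *\<^sub>R ?q w \<le> (\<Sum>S\<in>SS j z0. indicator (?T S) w *\<^sub>R ?q w)"
    proof (cases "w \<in> ?X")
      case True
      \<comment> \<open>One triangle containing \<open>w\<close> already contributes the full value
        of \<open>?q\<close> at \<open>w\<close>; the other summands are nonnegative.\<close>
      then obtain S where S: "S \<in> SS j z0" "w \<in> ?T S" using X by blast
      then show ?thesis
        using member_le_sum[of S "SS j z0" "\<lambda>S. indicator (?T S) w *\<^sub>R ?q w"] pos fin True
        by simp
    next
      case False
      then show ?thesis using pos by (simp add: sum_nonneg)
    qed
  qed
  also have "\<dots> = (\<Sum>S\<in>SS j z0. LINT w:?T S|lebesgue. ?q w)"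
    using int unfolding set_lebesgue_integral_def set_integrable_def
    by (intro Bochner_Integration.integral_sum) auto
  also have "\<dots> \<le> (\<Sum>S\<in>SS j z0. LINT w:?T S|lebesgue. ?Q S w)"
  proof (intro sum_mono set_integral_mono int set_integrable_q_tri)
    fix S w assume S: "S \<in> SS j z0" and w: "w \<in> ?T S"
    have "S \<in> grid_triangles k (orig j z0) (sz j z0)" using S by (simp add: SS[OF j z0] Sbar_def)
    then show "?q w \<le> ?Q S w"
      using grid q_le_q_tri[OF smooth[OF i j] _ _ _ TW[OF S] p hess[OF i j z0 S] w]
      by (simp add: grid_covers_def)
  qed
  finally show "(LINT w:?X|lebesgue. ?q w) \<le> (\<Sum>S\<in>SS j z0. LINT w:?T S|lebesgue. ?Q S w)" .
qed

end
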